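(* Let $\tau,\mu_1,\mu_2>0$. Suppose that $T_\tau(\Sigma)$, with state $x[k]$, input $u[k]\in\mathbb{R}^m$ and output $y[k]\in\mathbb{R}^m$, has passivity indices $(\nu',\rho')$ in the sense that, with a positive semi-definite storage function $\hat V(x)$, for any $k_0,k_1\in\mathbb{Z}_{\ge0}$ with $k_0<k_1$ and any admissible inputs, $$\hat V(x[k_1])-\hat V(x[k_0])\le\delta(x[k_0])+\sum_{k=k_0}^{k_1-1}\left(u[k]^\top y[k]-\nu'|u[k]|^2-\rho'|y[k]|^2\right),$$ where $\delta$ is the bias term described in the context. Let $\lambda_2,\lambda_3,\lambda_4,\lambda_5>0$ be arbitrary positive numbers. Then the sampled and input/output quantized system $\tilde T_\tau(\Sigma)$, with input $\tilde u[k]$ and output $\tilde y[k]$, satisfies, for any $k_0,k_1\in\mathbb{Z}_{\ge0}$ with $k_0<k_1$ and any admissible inputs, $$\hat V(x[k_1])-\hat V(x[k_0])\le\delta(x[k_0])+\sum_{k=k_0}^{k_1-1}\left(\tilde u[k]^\top\tilde y[k]-\tilde\nu|\tilde u[k]|^2-\tilde\rho|\tilde y[k]|^2+\tilde\delta\right),$$ where $$\tilde\nu=\nu'-\frac{|\nu'|}{\lambda_3}-\frac1{4\lambda_4},\qquad \tilde\rho=\rho'-\frac{|\rho'|}{\lambda_2}-\frac{1}{4\lambda_5},$$ $$\tilde\delta=\left[|\rho'|(1+\lambda_2)+\lambda_4\right]m\mu_2^2+\left[|\nu'|(1+\lambda_3)+\lambda_5\right]m\mu_1^2 .$$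
   Context: $|\cdot|$ is the Euclidean norm. $\Sigma$ is a continuous-time control system $\dot x=f(x,u)$, $y=h(x,u)$ with state in $\mathbb{R}^n$, input set $U\subseteq\mathbb{R}^m$, outputs in $\mathbb{R}^m$, $f$ Lipschitz, $h$ continuous, $f(0,0)=0$, $h(0,0)=0$, with unique trajectories. $T_\tau(\Sigma)$ is the discrete-time system obtained by zero-order hold and uniform sampling with period $\tau$: $x[k+1]$ is the state of $\Sigma$ reached at time $\tau$ from $x[k]$ under the constant input $u[k]$, and $y[k]=h(x[k],u[k])$. Bias term: $\delta(x)=w\beta(x)$ with $w=|\rho|\tau(1+\lambda_1)+1/\gamma$. Here $\rho$ is an output passivity index of $\Sigma$, $\lambda_1>0$ is arbitrary, and $\gamma>0$ and $\beta:\mathbb{R}^n\to\mathbb{R}_{\ge0}$ with $\beta(\mathbf 0)=0$ are such that $h(x,u)=h_1(x)+h_2(u)$ and $\int_0^T|\dot h_1(x(t))|^2dt\le\gamma^2\int_0^T|u(t)|^2dt+\beta(x_0)$ for all $x_0$, $T>0$ and admissible $u$. When the indices of $T_\tau(\Sigma)$ are obtained directly from its discrete-time dynamics (an inequality without bias term), $\delta\equiv0$. Uniform quantizer with precision $\mu$: $\mathcal Q(s)=\lfloor s/\mu\rfloor\mu$ if $s\ge0$ and $\mathcal Q(s)=\lceil s/\mu\rceil\mu$ if $s<0$, applied entrywise to vectors. $\tilde T_\tau(\Sigma)$ consists of $T_\tau(\Sigma)$ with an input quantizer $\mathcal Q_1$ (precision $\mu_1$) and an output quantizer $\mathcal Q_2$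 (precision $\mu_2$): given its input $\tilde u[k]$, the system $T_\tau(\Sigma)$ is driven by $u[k]=\mathcal Q_1(\tilde u[k])$, and its output is $\tilde y[k]=\mathcal Q_2(y[k])$; its state is the state $x[k]$ of $T_\tau(\Sigma)$. *)

theory Defs
  imports "HOL-Analysis.Analysis"
begin

section \<open>Continuous-time control systems\<close>

text \<open>
  The system x' = f(x,u), y = h(x,u). The field \<open>inputs\<close> is the set of input values and \<open>signals\<close>
  the class of admissible input signals on [0,\<open>\<infinity>\<close>). The values of \<open>dyn\<close> and \<open>outp\<close> at input values
  outside \<open>inputs\<close> and of signals and trajectories at negative times carry no meaning.
\<close>

record ('n, 'm) control_system =
  dyn :: "real ^ 'n \<Rightarrow> real ^ 'm \<Rightarrow> real ^ 'n"
  outp :: "real ^ 'n \<Rightarrow> real ^ 'm \<Rightarrow> real ^ 'm"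
  inputs :: "(real ^ 'm) set"
  signals :: "(real \<Rightarrow> real ^ 'm) set"

text \<open>Solutions in the sense of Caratheodory, written as an integral equation.\<close>

definition trajectory ::
  "('n::finite, 'm::finite) control_system \<Rightarrow> (real \<Rightarrow> real ^ 'm) \<Rightarrow> (real \<Rightarrow> real ^ 'n) \<Rightarrow> bool"
where
  "trajectory S u x \<longleftrightarrow>
     (\<forall>t\<ge>0. ((\<lambda>s. dyn S (x s) (u s)) has_integral (x t - x 0)) {0..t})"

text \<open>
  Admissible signals form a class of measurable, locally essentially bounded signals that contains
  the constant ones, so that zero-order hold inputs are available.
\<close>

definition control_system :: "('n::finite, 'm::finite) control_system \<Rightarrow> bool" where
  "control_system S \<longleftrightarrow>
     (\<exists>L. L-lipschitz_on (UNIV \<times> inputs S) (\<lambda>(x, u). dyn S x u)) \<and>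
     continuous_on (UNIV \<times> inputs S) (\<lambda>(x, u). outp S x u) \<and>
     dyn S 0 0 = 0 \<and> outp S 0 0 = 0 \<and>
     (\<forall>u\<in>signals S. (\<forall>t\<ge>0. u t \<in> inputs S) \<and>
        u \<in> borel_measurable (lebesgue_on {0..}) \<and>
        (\<forall>T. \<exists>B. AE t in lebesgue_on {0..T}. norm (u t) \<le> B)) \<and>
     (\<forall>v\<in>inputs S. (\<lambda>_. v) \<in> signals S) \<and>
     (\<forall>u\<in>signals S. \<forall>x0. \<exists>x. trajectory S u x \<and> x 0 = x0 \<and>
        (\<forall>x'. trajectory S u x' \<and> x' 0 = x0 \<longrightarrow> (\<forall>t\<ge>0. x' t = x t)))"

definition pos_semidef_fun :: "(real ^ 'n::finite \<Rightarrow> real) \<Rightarrow> bool" where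
  "pos_semidef_fun V \<longleftrightarrow> V 0 = 0 \<and> (\<forall>x. 0 \<le> V x)"

definition supply_rate :: "real \<Rightarrow> real \<Rightarrow> real ^ 'm::finite \<Rightarrow> real ^ 'm \<Rightarrow> real" where
  "supply_rate \<nu> \<rho> u y = u \<bullet> y - \<nu> * (norm u)\<^sup>2 - \<rho> * (norm y)\<^sup>2"

definition passivity_indices ::
  "('n::finite, 'm::finite) control_system \<Rightarrow> real \<Rightarrow> real \<Rightarrow> bool"
where
  "passivity_indices S \<nu> \<rho> \<longleftrightarrow>
     (\<exists>V. pos_semidef_fun V \<and>
       (\<forall>u\<in>signals S. \<forall>x t0 t1. trajectory S u x \<and> 0 \<le> t0 \<and> t0 \<le> t1 \<longrightarrow>
          (\<lambda>t. supply_rate \<nu> \<rho> (u t) (outp S (x t) (u t))) integrable_on {t0..t1} \<and>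
          V (x t1) - V (x t0) \<le>
            integral {t0..t1} (\<lambda>t. supply_rate \<nu> \<rho> (u t) (outp S (x t) (u t)))))"

definition output_passivity_index ::
  "('n::finite, 'm::finite) control_system \<Rightarrow> real \<Rightarrow> bool"
where
  "output_passivity_index S \<rho> \<longleftrightarrow> (\<exists>\<nu>. passivity_indices S \<nu> \<rho>)"


section \<open>Bias term\<close>

text \<open>
  The \<open>has_integral\<close> conjunct gives the time derivative of \<open>h1 (x t)\<close> a meaning along trajectories
  that are only differentiable almost everywhere: the function is the integral of its derivative.
  It also excludes the default values of \<open>vector_derivative\<close> and \<open>integral\<close>.
\<close>

definition output_rate_bound ::
  "('n::finite, 'm::finite) control_system \<Rightarrow> real \<Rightarrow> (real ^ 'n \<Rightarrow> real) \<Rightarrow> bool"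
where
  "output_rate_bound S \<gamma> \<beta> \<longleftrightarrow>
     (\<exists>h1 h2. (\<forall>x. \<forall>u\<in>inputs S. outp S x u = h1 x + h2 u) \<and>
       (\<forall>u\<in>signals S. \<forall>x T. trajectory S u x \<and> 0 < T \<longrightarrow>
          (let dh1 = (\<lambda>t. vector_derivative (\<lambda>s. h1 (x s)) (at t)) in
             (\<forall>t\<in>{0..T}. (dh1 has_integral (h1 (x t) - h1 (x 0))) {0..t}) \<and>
             (\<lambda>t. (norm (dh1 t))\<^sup>2) integrable_on {0..T} \<and>
             integral {0..T} (\<lambda>t. (norm (dh1 t))\<^sup>2) \<le>
               \<gamma>\<^sup>2 * integral {0..T} (\<lambda>t. (norm (u t))\<^sup>2) + \<beta> (x 0))))"

text \<open>
  The zero bias is the case in which the indices of the sampled system come directly from its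
  discrete-time dynamics.
\<close>

definition bias_term ::
  "('n::finite, 'm::finite) control_system \<Rightarrow> real \<Rightarrow> (real ^ 'n \<Rightarrow> real) \<Rightarrow> bool"
where
  "bias_term S \<tau> \<delta> \<longleftrightarrow>
     \<delta> = (\<lambda>_. 0) \<or>
     (\<exists>\<rho> l1 \<gamma> \<beta>. output_passivity_index S \<rho> \<and> 0 < l1 \<and> 0 < \<gamma> \<and>
        (\<forall>x. 0 \<le> \<beta> x) \<and> \<beta> 0 = 0 \<and> output_rate_bound S \<gamma> \<beta> \<and>
        \<delta> = (\<lambda>x. (\<bar>\<rho>\<bar> * \<tau> * (1 + l1) + 1 / \<gamma>) * \<beta> x))"


section \<open>Sampling and quantization\<close>

text \<open>Runs of the sampled system: input sequence, state sequence, output sequence.\<close>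

definition sampled_run ::
  "('n::finite, 'm::finite) control_system \<Rightarrow> real \<Rightarrow>
     (nat \<Rightarrow> real ^ 'm) \<Rightarrow> (nat \<Rightarrow> real ^ 'n) \<Rightarrow> (nat \<Rightarrow> real ^ 'm) \<Rightarrow> bool"
where
  "sampled_run S \<tau> u x y \<longleftrightarrow>
     (\<forall>k. u k \<in> inputs S \<and>
        (\<exists>\<xi>. trajectory S (\<lambda>_. u k) \<xi> \<and> \<xi> 0 = x k \<and> \<xi> \<tau> = x (Suc k)) \<and>
        y k = outp S (x k) (u k))"

definition quantize :: "real \<Rightarrow> real \<Rightarrow> real" where
  "quantize \<mu> s =
     (if 0 \<le> s then of_int \<lfloor>s / \<mu>\<rfloor> * \<mu> else of_int \<lceil>s / \<mu>\<rceil> * \<mu>)"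

definition quantize_vec :: "real \<Rightarrow> real ^ 'm::finite \<Rightarrow> real ^ 'm" where
  "quantize_vec \<mu> v = (\<chi> i. quantize \<mu> (v $ i))"

definition quantized_run ::
  "('n::finite, 'm::finite) control_system \<Rightarrow> real \<Rightarrow> real \<Rightarrow> real \<Rightarrow>
     (nat \<Rightarrow> real ^ 'm) \<Rightarrow> (nat \<Rightarrow> real ^ 'n) \<Rightarrow> (nat \<Rightarrow> real ^ 'm) \<Rightarrow> bool"
where
  "quantized_run S \<tau> \<mu>1 \<mu>2 u' x y' \<longleftrightarrow>
     (\<exists>y. sampled_run S \<tau> (\<lambda>k. quantize_vec \<mu>1 (u' k)) x y \<and>
        (\<forall>k. y' k = quantize_vec \<mu>2 (y k)))"

end

theory Submission
  imports Defs
begin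

text \<open>
  The storage function and the bias term are the same on both sides, and every run of the quantized
  system contains a run of the sampled one, driven by the quantized inputs. It is therefore enough
  to compare the two summands at each time step (lemma \<open>supply_rate_perturb_le\<close>).

  Write \<open>u = u' + e\<close> and \<open>y = y' + d\<close>, where \<open>e\<close> and \<open>d\<close> are the quantization errors. The product is
  split asymmetrically, as \<open>u \<bullet> y - u' \<bullet> y' = u \<bullet> d + e \<bullet> y'\<close>, so that no term \<open>e \<bullet> d\<close> appears. Young's
  inequality bounds \<open>u \<bullet> d\<close> by a multiple of \<open>|u|\<^sup>2\<close> plus a multiple of \<open>|d|\<^sup>2\<close>. The former must be
  charged to \<open>|u'|\<^sup>2\<close>; this is possible because the quantizer rounds towards zero, so that
  \<open>|u| \<le> |u'|\<close> (lemma \<open>norm_quantize_vec_le\<close>). The squared norms change by \<open>2 (u' \<bullet> e) + |e|\<^sup>2\<close> and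
  \<open>2 (y' \<bullet> d) + |d|\<^sup>2\<close>, to which Young's inequality applies again. Finally, each entry of a
  quantization error is at most the precision, hence its squared norm is at most the dimension
  times the squared precision.
\<close>

text \<open>Young's inequality: expand \<open>0 \<le> |a - 2 l b|\<^sup>2\<close> and divide by \<open>4 l\<close>.\<close>

lemma inner_le_Young:
  fixes a b :: "'a::real_inner"
  assumes "0 < l"
  shows "a \<bullet> b \<le> (norm a)\<^sup>2 / (4 * l) + l * (norm b)\<^sup>2"
proof -
  have "0 \<le> (norm (a - (2 * l) *\<^sub>R b))\<^sup>2" by simp
  also have "\<dots> = (norm a)\<^sup>2 + 4 * l\<^sup>2 * (norm b)\<^sup>2 - 4 * l * (a \<bullet> b)"
    unfolding power2_norm_eq_inner
    by (simp add: inner_diff inner_commute algebra_simps power2_eq_square)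
  finally show ?thesis
    using assms by (simp add: field_simps power2_eq_square)
qed

text \<open>
  The absolute value of \<open>c\<close> makes this usable for indices of either sign: it rests on the two-sided
  bound of \<open>|a + e|\<^sup>2 - |a|\<^sup>2 = 2 (a \<bullet> e) + |e|\<^sup>2\<close>.
\<close>

lemma scaled_norm_square_perturb_le:
  fixes a e :: "'a::real_inner"
  assumes "0 < l"
  shows "- c * (norm (a + e))\<^sup>2 \<le>
    - (c - \<bar>c\<bar> / l) * (norm a)\<^sup>2 + \<bar>c\<bar> * (1 + l) * (norm e)\<^sup>2"
proof -
  have eq: "(norm (a + e))\<^sup>2 - (norm a)\<^sup>2 = 2 * (a \<bullet> e) + (norm e)\<^sup>2"
    unfolding power2_norm_eq_inner by (simp add: inner_add inner_commute)
  \<comment> \<open>Half of \<open>l\<close>, because the inner product is doubled.\<close>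
  have up: "2 * (a \<bullet> e) \<le> (norm a)\<^sup>2 / l + l * (norm e)\<^sup>2"
    using inner_le_Young[of "l / 2" a e] assms by (simp add: field_simps)
  have lo: "- (2 * (a \<bullet> e)) \<le> (norm a)\<^sup>2 / l + l * (norm e)\<^sup>2"
    using inner_le_Young[of "l / 2" "- a" e] assms by (simp add: field_simps)
  have "\<bar>(norm (a + e))\<^sup>2 - (norm a)\<^sup>2\<bar> \<le> (norm a)\<^sup>2 / l + (1 + l) * (norm e)\<^sup>2"
    using up lo zero_le_power2[of "norm e"] unfolding eq abs_le_iff distrib_right by linarith
  then have "\<bar>c\<bar> * \<bar>(norm (a + e))\<^sup>2 - (norm a)\<^sup>2\<bar> \<le>
      \<bar>c\<bar> * ((norm a)\<^sup>2 / l + (1 + l) * (norm e)\<^sup>2)"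
    by (rule mult_left_mono) simp
  moreover have "- c * ((norm (a + e))\<^sup>2 - (norm a)\<^sup>2) \<le>
      \<bar>c\<bar> * \<bar>(norm (a + e))\<^sup>2 - (norm a)\<^sup>2\<bar>"
    by (metis abs_ge_self abs_minus_cancel abs_mult)
  ultimately show ?thesis
    by (simp add: algebra_simps)
qed

text \<open>
  Young's inequality bounds \<open>u \<bullet> (y - y')\<close> with a multiple of \<open>|u|\<^sup>2\<close>, which \<open>|u| \<le> |u'|\<close> turns into
  one of \<open>|u'|\<^sup>2\<close>; it bounds \<open>(u - u') \<bullet> y'\<close> with a multiple of \<open>|y'|\<^sup>2\<close>, which already has the
  desired form.
\<close>

lemma supply_rate_perturb_le:
  fixes u u' y y' :: "'a::real_inner"
  assumes "0 < l2" "0 < l3" "0 < l4" "0 < l5"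
    and "norm u \<le> norm u'"
    and "(norm (u - u'))\<^sup>2 \<le> E1" and "(norm (y - y'))\<^sup>2 \<le> E2"
  shows "u \<bullet> y - \<nu> * (norm u)\<^sup>2 - \<rho> * (norm y)\<^sup>2 \<le>
    u' \<bullet> y' - (\<nu> - \<bar>\<nu>\<bar> / l3 - 1 / (4 * l4)) * (norm u')\<^sup>2
      - (\<rho> - \<bar>\<rho>\<bar> / l2 - 1 / (4 * l5)) * (norm y')\<^sup>2
      + ((\<bar>\<rho>\<bar> * (1 + l2) + l4) * E2 + (\<bar>\<nu>\<bar> * (1 + l3) + l5) * E1)"
proof -
  define e d where "e = u - u'" and "d = y - y'"
  have eq: "u \<bullet> y = u' \<bullet> y' + u \<bullet> d + e \<bullet> y'"
    unfolding e_def d_def by (simp add: inner_diff)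
  have "u \<bullet> d \<le> (norm u)\<^sup>2 / (4 * l4) + l4 * (norm d)\<^sup>2"
    using inner_le_Young assms by blast
  moreover have "(norm u)\<^sup>2 / (4 * l4) \<le> (norm u')\<^sup>2 / (4 * l4)"
    using assms by (intro divide_right_mono power_mono) auto
  ultimately have ud: "u \<bullet> d \<le> 1 / (4 * l4) * (norm u')\<^sup>2 + l4 * (norm d)\<^sup>2"
    by simp
  have ey: "e \<bullet> y' \<le> 1 / (4 * l5) * (norm y')\<^sup>2 + l5 * (norm e)\<^sup>2"
    using inner_le_Young[of l5 y' e] assms by (simp add: inner_commute)
  have nu: "- \<nu> * (norm u)\<^sup>2 \<le>
      - (\<nu> - \<bar>\<nu>\<bar> / l3) * (norm u')\<^sup>2 + \<bar>\<nu>\<bar> * (1 + l3) * (norm e)\<^sup>2"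
    using scaled_norm_square_perturb_le[of l3 \<nu> u' e] assms by (simp add: e_def)
  have rho: "- \<rho> * (norm y)\<^sup>2 \<le>
      - (\<rho> - \<bar>\<rho>\<bar> / l2) * (norm y')\<^sup>2 + \<bar>\<rho>\<bar> * (1 + l2) * (norm d)\<^sup>2"
    using scaled_norm_square_perturb_le[of l2 \<rho> y' d] assms by (simp add: d_def)
  have E1: "(\<bar>\<nu>\<bar> * (1 + l3) + l5) * (norm e)\<^sup>2 \<le> (\<bar>\<nu>\<bar> * (1 + l3) + l5) * E1"
    using assms by (intro mult_left_mono) (auto simp: e_def)
  have E2: "(\<bar>\<rho>\<bar> * (1 + l2) + l4) * (norm d)\<^sup>2 \<le> (\<bar>\<rho>\<bar> * (1 + l2) + l4) * E2"
    using assms by (intro mult_left_mono) (auto simp: d_def)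
  show ?thesis
    using eq ud ey nu rho E1 E2
    unfolding left_diff_distrib distrib_right mult_minus_left minus_diff_eq by linarith
qed

lemma abs_quantize_diff_le:
  assumes "0 < \<mu>"
  shows "\<bar>quantize \<mu> s - s\<bar> \<le> \<mu>"
proof -
  have scale: "\<bar>t * \<mu> - s\<bar> \<le> \<mu>" if "\<bar>t - s / \<mu>\<bar> \<le> 1" for t
  proof -
    have "\<bar>t * \<mu> - s\<bar> = \<bar>(t - s / \<mu>) * \<mu>\<bar>"
      using assms by (simp add: left_diff_distrib)
    also have "\<dots> = \<bar>t - s / \<mu>\<bar> * \<mu>"
      using assms by (simp add: abs_mult)
    also have "\<dots> \<le> 1 * \<mu>"
      using assms that by (intro mult_right_mono) auto
    finally show ?thesis by simp
  qed
  have "\<bar>of_int \<lfloor>s / \<mu>\<rfloor> - s / \<mu>\<bar> \<le> 1" "\<bar>of_int \<lceil>s / \<mu>\<rceil> - s / \<mu>\<bar> \<le> 1"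
    by linarith+
  then show ?thesis
    using scale by (simp add: quantize_def)
qed

text \<open>Floor for nonnegative and ceiling for negative arguments: both round towards zero.\<close>

lemma abs_quantize_le:
  assumes "0 < \<mu>"
  shows "\<bar>quantize \<mu> s\<bar> \<le> \<bar>s\<bar>"
proof (cases "0 \<le> s")
  case True
  have "0 \<le> real_of_int \<lfloor>s / \<mu>\<rfloor>" using True assms by simp
  moreover have "of_int \<lfloor>s / \<mu>\<rfloor> * \<mu> \<le> s"
    using of_int_floor_le[of "s / \<mu>"] pos_le_divide_eq[OF assms] by blast
  ultimately show ?thesis using True assms by (simp add: quantize_def abs_mult)
next
  case False
  have "s / \<mu> \<le> 0" using False assms by (simp add: divide_le_0_iff)
  then have "real_of_int \<lceil>s / \<mu>\<rceil> \<le> 0" by simp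
  moreover have "s \<le> of_int \<lceil>s / \<mu>\<rceil> * \<mu>"
    using le_of_int_ceiling[of "s / \<mu>"] pos_divide_le_eq[OF assms] by blast
  ultimately show ?thesis using False assms by (simp add: quantize_def abs_mult)
qed

lemma norm_quantize_vec_le:
  assumes "0 < \<mu>"
  shows "norm (quantize_vec \<mu> v) \<le> norm v"
  by (rule norm_le_componentwise_cart) (simp add: quantize_vec_def abs_quantize_le[OF assms])

lemma norm_quantize_vec_diff_square_le:
  fixes v :: "real ^ 'm::finite"
  assumes "0 < \<mu>"
  shows "(norm (quantize_vec \<mu> v - v))\<^sup>2 \<le> real CARD('m) * \<mu>\<^sup>2"
proof -
  have "(norm (quantize_vec \<mu> v - v))\<^sup>2 = (\<Sum>i\<in>UNIV. (quantize \<mu> (v $ i) - v $ i)\<^sup>2)"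
    unfolding power2_norm_eq_inner inner_vec_def
    by (simp add: quantize_vec_def power2_eq_square)
  also have "\<dots> \<le> (\<Sum>i\<in>(UNIV :: 'm set). \<mu>\<^sup>2)"
    using abs_quantize_diff_le[OF assms] assms by (intro sum_mono abs_le_square_iff[THEN iffD1]) auto
  finally show ?thesis by simp
qed

theorem theorem2:
  fixes S :: "('n::finite, 'm::finite) control_system"
    and V \<delta> :: "real ^ 'n \<Rightarrow> real"
    and \<tau> \<mu>1 \<mu>2 \<nu>' \<rho>' l2 l3 l4 l5 :: real
  assumes "control_system S"
    and "0 < \<tau>" and "0 < \<mu>1" and "0 < \<mu>2"
    and "pos_semidef_fun V"
    and "bias_term S \<tau> \<delta>"
    and "\<And>u x y k0 k1. sampled_run S \<tau> u x y \<Longrightarrow> k0 < k1 \<Longrightarrow>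
           V (x k1) - V (x k0) \<le>
             \<delta> (x k0) +
             (\<Sum>k = k0..<k1. u k \<bullet> y k - \<nu>' * (norm (u k))\<^sup>2 - \<rho>' * (norm (y k))\<^sup>2)"
    and "0 < l2" and "0 < l3" and "0 < l4" and "0 < l5"
  defines "\<nu>t \<equiv> \<nu>' - \<bar>\<nu>'\<bar> / l3 - 1 / (4 * l4)"
    and "\<rho>t \<equiv> \<rho>' - \<bar>\<rho>'\<bar> / l2 - 1 / (4 * l5)"
    and "\<delta>t \<equiv> (\<bar>\<rho>'\<bar> * (1 + l2) + l4) * real CARD('m) * \<mu>2\<^sup>2 +
               (\<bar>\<nu>'\<bar> * (1 + l3) + l5) * real CARD('m) * \<mu>1\<^sup>2"
  shows "\<forall>u' x y' k0 k1. quantized_run S \<tau> \<mu>1 \<mu>2 u' x y' \<longrightarrow> k0 < k1 \<longrightarrow>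
           V (x k1) - V (x k0) \<le>
             \<delta> (x k0) +
             (\<Sum>k = k0..<k1. u' k \<bullet> y' k - \<nu>t * (norm (u' k))\<^sup>2 - \<rho>t * (norm (y' k))\<^sup>2 + \<delta>t)"
proof (intro allI impI)
  fix u' x y' and k0 k1 :: nat
  assume run: "quantized_run S \<tau> \<mu>1 \<mu>2 u' x y'" and "k0 < k1"
  define u where "u = (\<lambda>k. quantize_vec \<mu>1 (u' k))"
  obtain y where y: "sampled_run S \<tau> u x y" and y': "\<And>k. y' k = quantize_vec \<mu>2 (y k)"
    using run unfolding quantized_run_def u_def by blast
  have "u k \<bullet> y k - \<nu>' * (norm (u k))\<^sup>2 - \<rho>' * (norm (y k))\<^sup>2 \<le>
      u' k \<bullet> y' k - \<nu>t * (norm (u' k))\<^sup>2 - \<rho>t * (norm (y' k))\<^sup>2 + \<delta>t" for k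
  proof -
    have u_le: "norm (u k) \<le> norm (u' k)"
      using assms(3) by (simp add: u_def norm_quantize_vec_le)
    have u_err: "(norm (u k - u' k))\<^sup>2 \<le> real CARD('m) * \<mu>1\<^sup>2"
      using assms(3) by (simp add: u_def norm_quantize_vec_diff_square_le)
    have y_err: "(norm (y k - y' k))\<^sup>2 \<le> real CARD('m) * \<mu>2\<^sup>2"
      using assms(4) by (simp add: y' norm_minus_commute[of "y k"] norm_quantize_vec_diff_square_le)
    show ?thesis
      using supply_rate_perturb_le[OF assms(8-11) u_le u_err y_err]
      unfolding \<nu>t_def \<rho>t_def \<delta>t_def by (simp add: mult.assoc)
  qed
  then have "(\<Sum>k = k0..<k1. u k \<bullet> y k - \<nu>' * (norm (u k))\<^sup>2 - \<rho>' * (norm (y k))\<^sup>2) \<le>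
      (\<Sum>k = k0..<k1. u' k \<bullet> y' k - \<nu>t * (norm (u' k))\<^sup>2 - \<rho>t * (norm (y' k))\<^sup>2 + \<delta>t)"
    by (intro sum_mono)
  with assms(7)[OF y \<open>k0 < k1\<close>]
  show "V (x k1) - V (x k0) \<le> \<delta> (x k0) +
      (\<Sum>k = k0..<k1. u' k \<bullet> y' k - \<nu>t * (norm (u' k))\<^sup>2 - \<rho>t * (norm (y' k))\<^sup>2 + \<delta>t)"
    by linarith
qed

end
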